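(* Let $\mathcal{H}_A,\mathcal{H}_B,\mathcal{H}_C$ be finite-dimensional Hilbert spaces. For any strictly positive definite density matrix $\rho_{AB}$ on $\mathcal{H}_A\otimes\mathcal{H}_B$ and any strictly positive definite density matrix $\sigma_{BC}$ on $\mathcal{H}_B\otimes\mathcal{H}_C$, $$(\log \rho_{AB})\otimes I_C - (\log \rho_A)\otimes I_{BC} + I_A\otimes \log \sigma_{BC} - I_{AB}\otimes \log \sigma_C \;\leq\; 0$$ as operators on $\mathcal{H}_A\otimes\mathcal{H}_B\otimes\mathcal{H}_C$.
   Context: A density matrix is a positive semidefinite operator of trace one. Marginals are partial traces: $\rho_A=\mathrm{Tr}_B\,\rho_{AB}$, $\sigma_C=\mathrm{Tr}_B\,\sigma_{BC}$. $I_X$ denotes the identity on $\mathcal{H}_X$; $\log$ is the matrix logarithm of a positive definite operator. For Hermitian operators, $X\leq 0$ means $-X$ is positive semidefinite. *)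

theory Defs
  imports "HOL-Analysis.Analysis"
begin

text \<open>Finite-dimensional Hilbert space H_X is modelled as complex^'x for a finite
  index type 'x; operators are square matrices complex^'x^'x (entry M$i$j = row i, column j).
  Tensor products are indexed by product types.\<close>

type_synonym 'n cmat = "complex^'n^'n"

definition adj :: "'n::finite cmat \<Rightarrow> 'n cmat" where
  "adj M = (\<chi> i j. cnj (M $ j $ i))"

definition hermitian :: "'n::finite cmat \<Rightarrow> bool" where
  "hermitian M \<longleftrightarrow> adj M = M"

definition quad :: "'n::finite cmat \<Rightarrow> complex^'n \<Rightarrow> complex" where
  "quad M v = (\<Sum>i\<in>UNIV. \<Sum>j\<in>UNIV. cnj (v $ i) * M $ i $ j * v $ j)"

definition psd :: "'n::finite cmat \<Rightarrow> bool" where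
  "psd M \<longleftrightarrow> hermitian M \<and> (\<forall>v. 0 \<le> Re (quad M v))"

definition pos_def :: "'n::finite cmat \<Rightarrow> bool" where
  "pos_def M \<longleftrightarrow> hermitian M \<and> (\<forall>v. v \<noteq> 0 \<longrightarrow> 0 < Re (quad M v))"

definition mtrace :: "'n::finite cmat \<Rightarrow> complex" where
  "mtrace M = (\<Sum>i\<in>UNIV. M $ i $ i)"

definition density :: "'n::finite cmat \<Rightarrow> bool" where
  "density M \<longleftrightarrow> psd M \<and> mtrace M = 1"

definition unitary :: "'n::finite cmat \<Rightarrow> bool" where
  "unitary U \<longleftrightarrow> U ** adj U = mat 1 \<and> adj U ** U = mat 1"

definition cdiag :: "('n::finite \<Rightarrow> complex) \<Rightarrow> 'n cmat" where
  "cdiag d = (\<chi> i j. if i = j then d i else 0)"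

definition mlog :: "'n::finite cmat \<Rightarrow> 'n cmat" where
  "mlog A = (SOME L. \<exists>U d. unitary U \<and> (\<forall>i. 0 < d i) \<and>
      A = U ** cdiag (\<lambda>i. complex_of_real (d i)) ** adj U \<and>
      L = U ** cdiag (\<lambda>i. complex_of_real (ln (d i))) ** adj U)"

definition kron :: "'a::finite cmat \<Rightarrow> 'b::finite cmat \<Rightarrow> ('a \<times> 'b) cmat" where
  "kron X Y = (\<chi> p q. X $ fst p $ fst q * Y $ snd p $ snd q)"

definition tr_right :: "('a::finite \<times> 'b::finite) cmat \<Rightarrow> 'a cmat" where
  "tr_right M = (\<chi> i k. \<Sum>j\<in>UNIV. M $ (i,j) $ (k,j))"

definition tr_left :: "('a::finite \<times> 'b::finite) cmat \<Rightarrow> 'b cmat" where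
  "tr_left M = (\<chi> j l. \<Sum>i\<in>UNIV. M $ (i,j) $ (i,l))"

definition reassoc :: "(('a::finite \<times> 'b::finite) \<times> 'c::finite) cmat \<Rightarrow> ('a \<times> ('b \<times> 'c)) cmat" where
  "reassoc M = (\<chi> p q. M $ ((fst p, fst (snd p)), snd (snd p)) $ ((fst q, fst (snd q)), snd (snd q)))"

definition loewner_nonpos :: "'n::finite cmat \<Rightarrow> bool" where
  "loewner_nonpos X \<longleftrightarrow> psd (- X)"

end

theory Submission
  imports Defs "HOL-Complex_Analysis.Conformal_Mappings" "HOL-Real_Asymp.Real_Asymp"
begin

text \<open>Complex interpolation. Put $G(z) = \rho_{AB}^{z/2} (\rho_A^{-z/2} \otimes I_B)$,
  $H(z) = (I_B \otimes \sigma_C^{-z/2}) \sigma_{BC}^{z/2}$ and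
  $F(z) = (G(z) \otimes I_C)(I_A \otimes H(z))$. For $\mathrm{Re}\, z = 0$ all factors are unitary.
  For $\mathrm{Re}\, z = 1$ the partial traces over $B$ of $G^* G$ and $H H^*$ are identities, and
  moving $B$ to the other side turns $G$ into an isometry and $H$ into a coisometry, so
  $F(z)$ is again a contraction. By the three lines theorem $|\langle v, F(s) v\rangle| \le \|v\|^2$
  for $0 \le s \le 1$, with equality at $s = 0$. Hence the real part of the derivative at $0$ is
  nonpositive, and $F'(0)$ is half the operator of the theorem.\<close>

section \<open>The spectral theorem for Hermitian matrices\<close>

definition cdot :: "complex^'n::finite \<Rightarrow> complex^'n \<Rightarrow> complex" where
  "cdot x y = (\<Sum>i\<in>UNIV. cnj (x $ i) * y $ i)"

lemma inner_eq_Re_cdot: "x \<bullet> y = Re (cdot x y)"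
  by (simp add: cdot_def inner_vec_def inner_complex_def)

lemma cnj_cdot: "cnj (cdot x y) = cdot y x"
  by (simp add: cdot_def mult.commute)

lemma cdot_scaleR_right: "cdot x (r *\<^sub>R y) = of_real r * cdot x y"
  by (simp add: cdot_def sum_distrib_left scaleR_conv_of_real[where 'a=complex] mult_ac)

lemma cdot_smult_left: "cdot (c *s x) y = cnj c * cdot x y"
  by (simp add: cdot_def sum_distrib_left mult_ac)

lemma cdot_self: "cdot x x = of_real ((norm x)\<^sup>2)"
proof (rule complex_eqI)
  have "cnj (cdot x x) = cdot x x" by (rule cnj_cdot)
  then show "Im (cdot x x) = Im (of_real ((norm x)\<^sup>2))"
    by (metis Im_complex_of_real Reals_cnj_iff complex_is_Real_iff)
  show "Re (cdot x x) = Re (of_real ((norm x)\<^sup>2))"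
    by (simp add: inner_eq_Re_cdot[symmetric] power2_norm_eq_inner)
qed

lemma cdot_mult_right: "cdot x (M *v y) = cdot (adj M *v x) y"
proof -
  have "cdot x (M *v y) = (\<Sum>i\<in>UNIV. \<Sum>j\<in>UNIV. cnj (x $ i) * M $ i $ j * y $ j)"
    by (simp add: cdot_def matrix_vector_mult_def sum_distrib_left mult_ac)
  also have "\<dots> = (\<Sum>j\<in>UNIV. \<Sum>i\<in>UNIV. cnj (x $ i) * M $ i $ j * y $ j)"
    by (rule sum.swap)
  also have "\<dots> = cdot (adj M *v x) y"
    by (simp add: cdot_def adj_def matrix_vector_mult_def sum_distrib_left mult_ac)
  finally show ?thesis .
qed

lemma quad_eq_cdot: "quad M v = cdot v (M *v v)"
  by (simp add: quad_def cdot_def matrix_vector_mult_def sum_distrib_left mult_ac)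

lemma continuous_on_cdot [continuous_intros]:
  assumes "continuous_on S f" "continuous_on S g"
  shows "continuous_on S (\<lambda>x. cdot (f x) (g x))"
  unfolding cdot_def by (intro continuous_intros assms)

lemma continuous_on_matrix_vector [continuous_intros]:
  fixes M :: "'n::finite cmat"
  assumes "continuous_on S f"
  shows "continuous_on S (\<lambda>x. M *v f x)"
  unfolding matrix_vector_mult_def by (intro continuous_intros assms)

text \<open>Rayleigh's variational argument: the unit sphere of \<open>W\<close> is compact, so the
  quadratic form attains a maximum on it, and stationarity at the maximiser is the eigenvalue
  equation. Working with the real inner product makes \<open>l\<close> real from the start.\<close>

lemma hermitian_eigenvector_exists:
  fixes A :: "'n::finite cmat"
  assumes A: "hermitian A" and W: "subspace W" "closed W"
    and inv: "\<And>x. x \<in> W \<Longrightarrow> A *v x \<in> W" and x0: "x0 \<in> W" "x0 \<noteq> 0"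
  obtains v l where "v \<in> W" "norm v = 1" "A *v v = l *\<^sub>R v"
proof -
  have adjA: "adj A = A" using A by (simp add: hermitian_def)
  have sym: "x \<bullet> (A *v y) = (A *v x) \<bullet> y" for x y
    by (simp add: inner_eq_Re_cdot cdot_mult_right adjA)
  let ?S = "W \<inter> sphere 0 1"
  have "x0 /\<^sub>R norm x0 \<in> ?S"
    using x0 W by (auto simp: subspace_scale)
  moreover have "compact ?S" using W by (simp add: closed_Int_compact)
  moreover have "continuous_on ?S (\<lambda>x. x \<bullet> (A *v x))"
    by (intro continuous_intros)
  ultimately obtain v where v: "v \<in> ?S" and max: "\<And>x. x \<in> ?S \<Longrightarrow> x \<bullet> (A *v x) \<le> v \<bullet> (A *v v)"
    using continuous_attains_sup[of ?S "\<lambda>x. x \<bullet> (A *v x)"] by blast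
  define l where "l = v \<bullet> (A *v v)"
  have lin: "A *v (r *\<^sub>R x) = r *\<^sub>R (A *v x)" for r x
    by (simp add: vec_eq_iff matrix_vector_mult_def scaleR_conv_of_real[where 'a=complex] sum_distrib_left mult_ac)
  have le: "x \<bullet> (A *v x) \<le> l * (x \<bullet> x)" if "x \<in> W" for x
  proof (cases "x = 0")
    case True then show ?thesis by simp
  next
    case False
    have "x /\<^sub>R norm x \<in> ?S" using that False W by (auto simp: subspace_scale)
    from max[OF this] have "(x \<bullet> (A *v x)) / (norm x)\<^sup>2 \<le> l"
      by (simp add: lin l_def power2_eq_square divide_simps)
    then show ?thesis using False by (simp add: divide_simps power2_norm_eq_inner)
  qed
  \<comment> \<open>This is the residual of the eigenvalue equation. It lies in \<open>W\<close> by
    invariance, so every \<open>v + t w\<close> is an admissible competitor.\<close>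
  define w where "w = A *v v - l *\<^sub>R v"
  have wW: "w \<in> W" unfolding w_def using v W inv by (auto intro!: subspace_diff subspace_scale)
  have vv: "v \<bullet> v = 1" using v by (simp add: power2_norm_eq_inner[symmetric])
  \<comment> \<open>Maximality tested at \<open>v + t w\<close>: the left side is of first order in
    \<open>t\<close>, the right side of second order, so a small positive \<open>t\<close> forces
    \<open>w\<close> to vanish.\<close>
  have ineq: "2 * t * (w \<bullet> w) \<le> t\<^sup>2 * (l * (w \<bullet> w) - w \<bullet> (A *v w))" for t
  proof -
    have "v + t *\<^sub>R w \<in> W" using wW v W by (auto intro!: subspace_add subspace_scale)
    from le[OF this]
    have "(v + t *\<^sub>R w) \<bullet> (A *v v + t *\<^sub>R (A *v w)) \<le> l * ((v + t *\<^sub>R w) \<bullet> (v + t *\<^sub>R w))"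
      by (simp add: matrix_vector_right_distrib lin)
    then have 1: "l + t * (v \<bullet> (A *v w)) + t * (w \<bullet> (A *v v)) + t\<^sup>2 * (w \<bullet> (A *v w))
       \<le> l * (1 + 2 * t * (w \<bullet> v) + t\<^sup>2 * (w \<bullet> w))"
      by (simp add: inner_add_left inner_add_right vv l_def power2_eq_square inner_commute algebra_simps)
    have 2: "v \<bullet> (A *v w) = w \<bullet> (A *v v)" by (metis sym inner_commute)
    have 3: "w \<bullet> w = w \<bullet> (A *v v) - l * (w \<bullet> v)"
      by (subst (2) w_def) (simp add: inner_diff_right)
    show ?thesis using 1 unfolding 2 by (simp add: 3 algebra_simps)
  qed
  have "w \<bullet> w \<le> 0"
  proof (rule ccontr)
    assume "\<not> w \<bullet> w \<le> 0"
    then have p: "w \<bullet> w > 0" by (simp only: not_le)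
    define K where "K = \<bar>l * (w \<bullet> w) - w \<bullet> (A *v w)\<bar> + 1"
    have K: "K > 0" "l * (w \<bullet> w) - w \<bullet> (A *v w) \<le> K" unfolding K_def by auto
    \<comment> \<open>With this \<open>t\<close> the bound \<open>t^2 K\<close> equals
      \<open>t (w \<bullet> w)\<close>, only half of the left side of \<open>ineq\<close>. The
      \<open>+ 1\<close> in \<open>K\<close> keeps the denominator positive.\<close>
    define t where "t = (w \<bullet> w) / K"
    have t: "t > 0" using p K by (simp add: t_def)
    have "2 * t * (w \<bullet> w) \<le> t\<^sup>2 * K"
      using ineq[of t] mult_left_mono[OF K(2), of "t\<^sup>2"] by simp
    also have "\<dots> = t * (w \<bullet> w)" using K by (simp add: t_def power2_eq_square)
    finally show False using p t by simp
  qed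
  then have "w = 0" by (metis inner_gt_zero_iff not_le)
  then have "A *v v = l *\<^sub>R v" by (simp add: w_def)
  with v that show thesis by auto
qed

text \<open>Induction on the index set: the next eigenvector is sought in the complex orthogonal
  complement of those already found, which \<open>A\<close> preserves because it is
  Hermitian.\<close>

lemma hermitian_orthonormal_eigenvectors:
  fixes A :: "'n::finite cmat" and S :: "'n set"
  assumes A: "hermitian A"
  shows "\<exists>v d. (\<forall>i\<in>S. \<forall>j\<in>S. cdot (v i) (v j) = (if i = j then 1 else 0)) \<and>
           (\<forall>i\<in>S. A *v v i = (d i :: real) *\<^sub>R v i)"
proof (induction S rule: finite_induct[OF finite])
  case 1 then show ?case by simp
next
  case (2 k S)
  then obtain v d where on: "\<And>i j. i\<in>S \<Longrightarrow> j\<in>S \<Longrightarrow> cdot (v i) (v j) = (if i = j then 1 else 0)"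
    and ev: "\<And>i. i\<in>S \<Longrightarrow> A *v v i = (d i :: real) *\<^sub>R v i" by blast
  define W where "W = {x. \<forall>i\<in>S. cdot (v i) x = 0}"
  \<comment> \<open>Real orthogonality to \<open>v i\<close> and to its multiple by the imaginary
    unit kills the real and the imaginary part of \<open>cdot (v i) x\<close>.\<close>
  define T where "T = v ` S \<union> (\<lambda>i. \<i> *s v i) ` S"
  have adjA: "adj A = A" using A by (simp add: hermitian_def)
  have sub: "subspace W"
    by (auto simp: W_def subspace_def cdot_scaleR_right)
       (auto simp: cdot_def algebra_simps sum.distrib)
  have "W = (\<Inter>i\<in>S. {x. cdot (v i) x = 0})" by (auto simp: W_def)
  also have "closed \<dots>"
    by (intro closed_INT ballI closed_Collect_eq continuous_intros)
  finally have cl: "closed W" .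
  have inv: "A *v x \<in> W" if "x \<in> W" for x
    using that ev by (auto simp: W_def cdot_mult_right adjA)
       (metis cdot_scaleR_right cnj_cdot complex_cnj_zero_iff mult_eq_0_iff)
  have "S \<subset> UNIV" using 2 by auto
  then have "card S < CARD('n)" by (intro psubset_card_mono) auto
  \<comment> \<open>Count of real dimensions: at most two vectors for each index in
    \<open>S\<close>, against twice \<open>CARD('n)\<close> for the whole space, so a nonzero vector
    orthogonal to \<open>T\<close> remains.\<close>
  have "card T \<le> card (v ` S) + card ((\<lambda>i. \<i> *s v i) ` S)"
    unfolding T_def by (rule card_Un_le)
  also have "\<dots> \<le> card S + card S" by (intro add_mono card_image_le) auto
  also have "\<dots> < DIM(complex^'n)" using \<open>card S < CARD('n)\<close> by simp
  finally have "card T < DIM(complex^'n)" .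
  moreover have "dim T \<le> card T" by (rule dim_le_card') (simp add: T_def)
  ultimately obtain x where x: "x \<noteq> 0" "\<And>y. y \<in> span T \<Longrightarrow> orthogonal x y"
    using orthogonal_to_subspace_exists[of T] by auto
  have "x \<in> W" unfolding W_def
  proof (intro CollectI ballI)
    fix i assume "i \<in> S"
    then have "v i \<in> T" "\<i> *s v i \<in> T" by (auto simp: T_def)
    then have "v i \<bullet> x = 0" "(\<i> *s v i) \<bullet> x = 0"
      using x(2)[OF span_base] by (auto simp: orthogonal_def inner_commute[of _ x])
    then show "cdot (v i) x = 0"
      by (auto simp: inner_eq_Re_cdot cdot_smult_left complex_eq_iff)
  qed
  with hermitian_eigenvector_exists[OF A sub cl inv _ x(1)]
  obtain u l where u: "u \<in> W" "norm u = 1" "A *v u = l *\<^sub>R u" by blast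
  have 1: "cdot (v i) u = 0" if "i \<in> S" for i using u(1) that by (auto simp: W_def)
  then have 3: "cdot u (v i) = 0" if "i \<in> S" for i using that by (metis cnj_cdot complex_cnj_zero)
  have 4: "cdot u u = 1" using u by (simp add: cdot_self)
  show ?case
    by (rule exI[of _ "v(k := u)"], rule exI[of _ "d(k := l)"])
       (use 2 1 3 4 u on ev in auto)
qed

lemma spectral_pos_def:
  fixes A :: "'n::finite cmat"
  assumes "pos_def A"
  shows "\<exists>U d. unitary U \<and> (\<forall>i. 0 < d i) \<and> A = U ** cdiag (\<lambda>i. complex_of_real (d i)) ** adj U"
proof -
  have "hermitian A" using assms by (simp add: pos_def_def)
  from hermitian_orthonormal_eigenvectors[OF this, of UNIV] obtain v and d :: "'n \<Rightarrow> real"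
    where on: "\<And>i j. cdot (v i) (v j) = (if i = j then 1 else 0)"
    and ev: "\<And>i. A *v v i = d i *\<^sub>R v i" by auto
  define U where "U = (\<chi> r i. v i $ r)"
  have 1: "adj U ** U = mat 1"
    using on by (simp add: vec_eq_iff matrix_matrix_mult_def adj_def U_def cdot_def mat_def)
  then have 2: "U ** adj U = mat 1" by (simp add: matrix_left_right_inverse)
  have "(A ** U) $ r $ i = (U ** cdiag (\<lambda>i. complex_of_real (d i))) $ r $ i" for r i
  proof -
    have "(A ** U) $ r $ i = (A *v v i) $ r"
      by (simp add: matrix_matrix_mult_def matrix_vector_mult_def U_def)
    also have "\<dots> = v i $ r * of_real (d i)" by (simp add: ev scaleR_conv_of_real[where 'a=complex])
    also have "\<dots> = (U ** cdiag (\<lambda>i. complex_of_real (d i))) $ r $ i"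
      by (simp add: matrix_matrix_mult_def U_def cdiag_def if_distrib cong: if_cong)
    finally show ?thesis .
  qed
  then have "A ** U = U ** cdiag (\<lambda>i. complex_of_real (d i))" by (simp add: vec_eq_iff)
  then have "A ** (U ** adj U) = U ** cdiag (\<lambda>i. complex_of_real (d i)) ** adj U"
    by (simp add: matrix_mul_assoc)
  then have 3: "A = U ** cdiag (\<lambda>i. complex_of_real (d i)) ** adj U" by (simp add: 2)
  have "0 < d i" for i
  proof -
    have "v i \<noteq> 0" using on[of i i] by (auto simp: cdot_def)
    then have "0 < Re (quad A (v i))" using assms by (simp add: pos_def_def)
    also have "\<dots> = d i" by (simp add: quad_eq_cdot ev cdot_scaleR_right on)
    finally show ?thesis .
  qed
  with 1 2 3 show ?thesis by (auto simp: unitary_def)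
qed

section \<open>The three lines theorem\<close>

text \<open>The strip is unbounded, so the maximum principle is applied on a large rectangle to
  \<open>f\<close> times a Gaussian factor that decays along the strip. The a priori bound
  \<open>B\<close> controls the horizontal sides, and the factor is removed at the end by letting
  \<open>e\<close> tend to 0.\<close>

lemma three_lines_bound:
  fixes f :: "complex \<Rightarrow> complex"
  assumes hol: "f holomorphic_on UNIV"
    and bdd: "\<And>z. 0 \<le> Re z \<Longrightarrow> Re z \<le> 1 \<Longrightarrow> norm (f z) \<le> B"
    and bdry: "\<And>z. Re z = 0 \<or> Re z = 1 \<Longrightarrow> norm (f z) \<le> M"
    and M: "0 < M" and z: "0 \<le> Re z" "Re z \<le> 1"
  shows "norm (f z) \<le> M"
proof (cases "B \<le> 0")
  case True
  then show ?thesis using bdd[OF z] M by simp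
next
  case False
  then have B: "B > 0" by simp
  have key: "norm (f z) \<le> M * exp (e * (1 - Re (z\<^sup>2)))" if e: "e > 0" for e
  proof -
    \<comment> \<open>Subtracting 1 from the square gives the factor modulus at most 1 on the strip,
      where \<open>Re w\<close> is at most 1.\<close>
    define g where "g w = f w * exp (of_real e * (w\<^sup>2 - 1))" for w
    have norm_g: "norm (g w) = norm (f w) * exp (e * ((Re w)\<^sup>2 - (Im w)\<^sup>2 - 1))" for w
      by (simp add: g_def norm_mult norm_exp power2_eq_square)
    have "((\<lambda>R. B * exp (- (e * R\<^sup>2))) \<longlongrightarrow> 0) at_top" using e by real_asymp
    then have "\<forall>\<^sub>F R in at_top. B * exp (- (e * R\<^sup>2)) < M"
      using M by (rule order_tendstoD)
    then have "\<forall>\<^sub>F R in at_top. B * exp (- (e * R\<^sup>2)) < M \<and> R > \<bar>Im z\<bar>"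
      using eventually_gt_at_top eventually_conj by blast
    \<comment> \<open>The first property brings the horizontal sides below \<open>M\<close>; the
      second puts \<open>z\<close> inside the rectangle.\<close>
    then obtain R where R: "B * exp (- (e * R\<^sup>2)) < M" "R > \<bar>Im z\<bar>"
      by (blast dest: eventually_happens'[OF trivial_limit_at_top_linorder])
    let ?S = "cbox (Complex 0 (-R)) (Complex 1 R)"
    have "norm (g z) \<le> M"
    proof (rule maximum_modulus_frontier[of g ?S])
      have "g holomorphic_on UNIV" unfolding g_def
        by (intro holomorphic_intros hol)
      then show "g holomorphic_on interior ?S" "continuous_on (closure ?S) g"
        using holomorphic_on_subset holomorphic_on_imp_continuous_on continuous_on_subset by blast+
      show "bounded ?S" by simp
      show "z \<in> ?S" using z R by (auto simp: in_cbox_complex_iff)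
      fix w assume "w \<in> frontier ?S"
      then have w: "w \<in> ?S" "w \<notin> box (Complex 0 (-R)) (Complex 1 R)"
        by (auto simp: frontier_def)
      then have re: "0 \<le> Re w" "Re w \<le> 1" by (auto simp: in_cbox_complex_iff)
      then have re2: "(Re w)\<^sup>2 \<le> 1" by (simp add: power_le_one)
      consider "Re w = 0 \<or> Re w = 1" | "\<bar>Im w\<bar> = R"
        using w by (force simp: in_cbox_complex_iff in_box_complex_iff)
      then show "norm (g w) \<le> M"
      proof cases
        case 1
        have "e * ((Re w)\<^sup>2 - (Im w)\<^sup>2 - 1) \<le> 0"
          using re2 e by (intro mult_nonneg_nonpos) (auto simp: field_simps add_increasing2)
        then have "norm (g w) \<le> M * 1"
          unfolding norm_g using bdry[OF 1] M by (intro mult_mono) auto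
        then show ?thesis by simp
      next
        case 2
        then have im: "(Im w)\<^sup>2 = R\<^sup>2" by (metis power2_abs)
        have "e * ((Re w)\<^sup>2 - (Im w)\<^sup>2 - 1) \<le> e * - R\<^sup>2"
          using re2 e im by (intro mult_left_mono) auto
        then have "norm (g w) \<le> B * exp (- (e * R\<^sup>2))"
          unfolding norm_g using bdd[OF re] B by (intro mult_mono) auto
        with R show ?thesis by simp
      qed
    qed
    then show ?thesis
      unfolding norm_g by (simp add: power2_eq_square exp_diff exp_minus field_simps exp_add)
  qed
  have "((\<lambda>e. M * exp (e * (1 - Re (z\<^sup>2)))) \<longlongrightarrow> M * exp (0 * (1 - Re (z\<^sup>2)))) (at_right 0)"
    by (intro tendsto_intros)
  moreover have "\<forall>\<^sub>F e in at_right 0. norm (f z) \<le> M * exp (e * (1 - Re (z\<^sup>2)))"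
    by (rule eventually_mono[OF eventually_at_right_less]) (rule key)
  ultimately have "norm (f z) \<le> M * exp (0 * (1 - Re (z\<^sup>2)))"
    by (rule tendsto_lowerbound) simp
  then show ?thesis by simp
qed

section \<open>Isometries, tensor products and partial traces\<close>

text \<open>This is the norm identity for a kernel with orthonormal columns. Scalar sums over
  arbitrary finite index sets let it apply after any regrouping of tensor indices, also to
  rectangular kernels.\<close>

lemma sum_isometry:
  fixes K :: "'i \<Rightarrow> 'j \<Rightarrow> complex"
  assumes "finite I" "finite J"
    and "\<And>j j'. j \<in> J \<Longrightarrow> j' \<in> J \<Longrightarrow> (\<Sum>i\<in>I. cnj (K i j) * K i j') = (if j = j' then 1 else 0)"
  shows "(\<Sum>i\<in>I. (norm (\<Sum>j\<in>J. K i j * x j))\<^sup>2) = (\<Sum>j\<in>J. (norm (x j))\<^sup>2)"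
proof -
  have "complex_of_real (\<Sum>i\<in>I. (norm (\<Sum>j\<in>J. K i j * x j))\<^sup>2)
      = (\<Sum>i\<in>I. cnj (\<Sum>j\<in>J. K i j * x j) * (\<Sum>j\<in>J. K i j * x j))"
    by (simp only: of_real_sum complex_norm_square mult.commute)
  also have "\<dots> = (\<Sum>i\<in>I. \<Sum>j\<in>J. \<Sum>j'\<in>J. cnj (x j) * x j' * (cnj (K i j) * K i j'))"
    by (simp only: cnj_sum complex_cnj_mult sum_product) (simp only: mult_ac)
  also have "\<dots> = (\<Sum>j\<in>J. \<Sum>i\<in>I. \<Sum>j'\<in>J. cnj (x j) * x j' * (cnj (K i j) * K i j'))"
    by (rule sum.swap)
  also have "\<dots> = (\<Sum>j\<in>J. \<Sum>j'\<in>J. \<Sum>i\<in>I. cnj (x j) * x j' * (cnj (K i j) * K i j'))"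
    by (intro sum.cong refl sum.swap)
  also have "\<dots> = (\<Sum>j\<in>J. \<Sum>j'\<in>J. cnj (x j) * x j' * (if j = j' then 1 else 0))"
    by (intro sum.cong refl) (simp add: assms(3) flip: sum_distrib_left)
  also have "\<dots> = (\<Sum>j\<in>J. cnj (x j) * x j)"
    using assms(2) by (intro sum.cong refl) (simp add: if_distrib cong: if_cong)
  also have "\<dots> = complex_of_real (\<Sum>j\<in>J. (norm (x j))\<^sup>2)"
    by (simp only: of_real_sum complex_norm_square mult.commute)
  finally show ?thesis by (simp only: of_real_eq_iff)
qed

text \<open>Let \<open>y\<close> be the image of \<open>x\<close>, and let \<open>z\<close> be the
  image of \<open>y\<close> under the adjoint kernel, which is an isometry. Then \<open>z\<close>
  has the norm of \<open>y\<close> and its inner product with \<open>x\<close> is the squared norm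
  of \<open>y\<close>, so expanding the squared norm of \<open>x - z\<close> gives the
  claim.\<close>

lemma sum_coisometry:
  fixes K :: "'i \<Rightarrow> 'j \<Rightarrow> complex"
  assumes "finite I" "finite J"
    and "\<And>i i'. i \<in> I \<Longrightarrow> i' \<in> I \<Longrightarrow> (\<Sum>j\<in>J. K i j * cnj (K i' j)) = (if i = i' then 1 else 0)"
  shows "(\<Sum>i\<in>I. (norm (\<Sum>j\<in>J. K i j * x j))\<^sup>2) \<le> (\<Sum>j\<in>J. (norm (x j))\<^sup>2)"
proof -
  define y where "y i = (\<Sum>j\<in>J. K i j * x j)" for i
  define z where "z j = (\<Sum>i\<in>I. cnj (K i j) * y i)" for j
  have zy: "(\<Sum>j\<in>J. (norm (z j))\<^sup>2) = (\<Sum>i\<in>I. (norm (y i))\<^sup>2)"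
    unfolding z_def using sum_isometry[of J I "\<lambda>j i. cnj (K i j)" y] assms by simp
  have "(\<Sum>j\<in>J. cnj (z j) * x j) = (\<Sum>j\<in>J. \<Sum>i\<in>I. cnj (y i) * (K i j * x j))"
    by (simp add: z_def sum_distrib_right sum_distrib_left mult_ac)
  also have "\<dots> = (\<Sum>i\<in>I. \<Sum>j\<in>J. cnj (y i) * (K i j * x j))" by (rule sum.swap)
  also have "\<dots> = (\<Sum>i\<in>I. cnj (y i) * y i)" by (simp add: y_def flip: sum_distrib_left)
  also have "\<dots> = complex_of_real (\<Sum>i\<in>I. (norm (y i))\<^sup>2)"
    by (simp only: of_real_sum complex_norm_square mult.commute)
  finally have zx: "Re (\<Sum>j\<in>J. cnj (z j) * x j) = (\<Sum>i\<in>I. (norm (y i))\<^sup>2)" by simp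
  have "0 \<le> (\<Sum>j\<in>J. (norm (x j - z j))\<^sup>2)" by (simp add: sum_nonneg)
  also have "\<dots> = (\<Sum>j\<in>J. (norm (x j))\<^sup>2 - 2 * Re (cnj (z j) * x j) + (norm (z j))\<^sup>2)"
    by (intro sum.cong refl) (simp add: cmod_power2, simp add: power2_eq_square algebra_simps)
  also have "\<dots> = (\<Sum>j\<in>J. (norm (x j))\<^sup>2) - (\<Sum>i\<in>I. (norm (y i))\<^sup>2)"
    using zx by (simp add: sum.distrib sum_subtractf zy flip: sum_distrib_left)
  finally show ?thesis by (simp add: y_def)
qed

section \<open>Sums over product indices, adjoints and Kronecker products\<close>

lemma sum_UNIV_prod: "(\<Sum>p\<in>UNIV. f p) = (\<Sum>a\<in>(UNIV::'a::finite set). \<Sum>b\<in>(UNIV::'b::finite set). f (a, b))"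
  by (simp add: sum.cartesian_product)

lemma sum_if_const: "(\<Sum>i\<in>A. if P then f i else 0) = (if P then \<Sum>i\<in>A. f i else 0)"
  by simp

lemma norm_vec_sq: "(norm (v :: complex^'n::finite))\<^sup>2 = (\<Sum>i\<in>UNIV. (norm (v $ i))\<^sup>2)"
  by (simp add: norm_vec_def L2_set_def sum_nonneg)

lemma norm_cdot_le: "norm (cdot x y) \<le> norm x * norm y"
proof -
  have "norm (cdot x y) \<le> (\<Sum>i\<in>UNIV. \<bar>norm (x $ i)\<bar> * \<bar>norm (y $ i)\<bar>)"
    unfolding cdot_def by (rule sum_norm_le) (simp add: norm_mult)
  also have "\<dots> \<le> norm x * norm y"
    unfolding norm_vec_def by (rule L2_set_mult_ineq)
  finally show ?thesis .
qed

lemma adj_adj [simp]: "adj (adj A) = A"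
  by (simp add: adj_def vec_eq_iff)

lemma adj_mult: "adj (A ** B) = adj B ** adj A"
  by (simp add: adj_def vec_eq_iff matrix_matrix_mult_def mult.commute)

lemma adj_cdiag: "adj (cdiag f) = cdiag (\<lambda>i. cnj (f i))"
  by (auto simp: adj_def cdiag_def vec_eq_iff)

lemma cdiag_mult: "cdiag f ** cdiag g = cdiag (\<lambda>i. f i * g i)"
  by (auto simp: cdiag_def vec_eq_iff matrix_matrix_mult_def mult_delta_left mult_delta_right)

lemma cdiag_one: "cdiag (\<lambda>i. 1) = mat 1"
  by (simp add: cdiag_def mat_def)

lemma adj_one [simp]: "adj (mat 1) = mat 1"
  by (auto simp: adj_def mat_def vec_eq_iff)

lemma adj_kron: "adj (kron X Y) = kron (adj X) (adj Y)"
  by (simp add: adj_def kron_def vec_eq_iff)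

lemma adj_reassoc: "adj (reassoc M) = reassoc (adj M)"
  by (simp add: adj_def reassoc_def vec_eq_iff)

lemma kron_mult: "kron X Y ** kron X' Y' = kron (X ** X') (Y ** Y')"
  by (simp add: kron_def vec_eq_iff matrix_matrix_mult_def sum_UNIV_prod sum_product mult_ac)

lemma kron_one [simp]: "kron (mat 1) (mat 1) = mat 1"
  by (auto simp: kron_def vec_eq_iff mat_def prod_eq_iff)

text \<open>An operator on the kept factor leaves the traced index alone, so it can be pulled out of
  the partial trace. This rule and its three variants turn a sandwiched joint density matrix into a
  product of powers of its marginal.\<close>

lemma tr_right_kron_left: "tr_right (kron X (mat 1) ** M) = X ** tr_right M"
  by (simp add: tr_right_def kron_def vec_eq_iff matrix_matrix_mult_def sum_UNIV_prod mat_def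
      mult_delta_left mult_delta_right sum_distrib_left) (auto intro: sum.swap)

lemma tr_right_kron_right: "tr_right (M ** kron X (mat 1)) = tr_right M ** X"
  by (simp add: tr_right_def kron_def vec_eq_iff matrix_matrix_mult_def sum_UNIV_prod mat_def
      mult_delta_left mult_delta_right sum_distrib_right) (auto intro: sum.swap)

lemma tr_left_kron_left: "tr_left (kron (mat 1) X ** M) = X ** tr_left M"
  by (simp add: tr_left_def kron_def vec_eq_iff matrix_matrix_mult_def sum_UNIV_prod mat_def
      mult_delta_left mult_delta_right sum_distrib_left sum_if_const) (auto intro: sum.swap)

lemma tr_left_kron_right: "tr_left (M ** kron (mat 1) X) = tr_left M ** X"
  by (simp add: tr_left_def kron_def vec_eq_iff matrix_matrix_mult_def sum_UNIV_prod mat_def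
      mult_delta_left mult_delta_right sum_distrib_right sum_if_const) (auto intro: sum.swap)

section \<open>Positivity of the marginals\<close>

lemma cnj_if_zero: "cnj (if P then x else 0) = (if P then cnj x else 0)"
  by simp

text \<open>The vectors on the right are the products of \<open>v\<close> with the basis vectors of
  the traced factor. They are nonzero when \<open>v\<close> is, which is how positive definiteness
  passes to the marginal.\<close>

lemma quad_tr_right: "quad (tr_right M) v = (\<Sum>j\<in>UNIV. quad M (\<chi> p. if snd p = j then v $ fst p else 0))"
proof -
  have "quad M (\<chi> p. if snd p = j then v $ fst p else 0)
     = (\<Sum>i\<in>UNIV. \<Sum>k\<in>UNIV. cnj (v $ i) * M $ (i, j) $ (k, j) * v $ k)" for j
    by (simp add: quad_def sum_UNIV_prod cnj_if_zero mult_delta_left mult_delta_right sum_if_const)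
  then show ?thesis
    by (simp add: quad_def tr_right_def sum_distrib_left sum_distrib_right
        sum.swap[where A="UNIV::'b set" and B="UNIV::'a set"])
qed

lemma quad_tr_left: "quad (tr_left M) v = (\<Sum>j\<in>UNIV. quad M (\<chi> p. if fst p = j then v $ snd p else 0))"
proof -
  have "quad M (\<chi> p. if fst p = j then v $ snd p else 0)
     = (\<Sum>i\<in>UNIV. \<Sum>k\<in>UNIV. cnj (v $ i) * M $ (j, i) $ (j, k) * v $ k)" for j
    by (simp add: quad_def sum_UNIV_prod cnj_if_zero mult_delta_left mult_delta_right sum_if_const)
  then show ?thesis
    by (simp add: quad_def tr_left_def sum_distrib_left sum_distrib_right
        sum.swap[where A="UNIV::'a set" and B="UNIV::'b set"])
qed

lemma cnj_hermitian: "hermitian M \<Longrightarrow> cnj (M $ p $ q) = M $ q $ p"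
  by (simp add: hermitian_def adj_def vec_eq_iff)

lemma pos_def_tr_right:
  assumes "pos_def M" shows "pos_def (tr_right M)"
  unfolding pos_def_def
proof safe
  have "cnj (M $ p $ q) = M $ q $ p" for p q
    using assms by (intro cnj_hermitian) (simp add: pos_def_def)
  then show "hermitian (tr_right M)" by (simp add: hermitian_def adj_def tr_right_def vec_eq_iff)
  fix v :: "complex^'a" assume "v \<noteq> 0"
  then obtain i where "v $ i \<noteq> 0" by (auto simp: vec_eq_iff)
  have "(\<chi> p. if snd p = j then v $ fst p else 0) \<noteq> 0" for j :: 'b
  proof
    assume "(\<chi> p. if snd p = j then v $ fst p else 0) = 0"
    from arg_cong[OF this, of "\<lambda>x. x $ (i, j)"] show False
      using \<open>v $ i \<noteq> 0\<close> by simp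
  qed
  then have "0 < Re (quad M (\<chi> p. if snd p = j then v $ fst p else 0))" for j :: 'b
    using assms unfolding pos_def_def by blast
  then show "0 < Re (quad (tr_right M) v)"
    unfolding quad_tr_right Re_sum by (intro sum_pos) simp_all
qed

lemma pos_def_tr_left:
  assumes "pos_def M" shows "pos_def (tr_left M)"
  unfolding pos_def_def
proof safe
  have "cnj (M $ p $ q) = M $ q $ p" for p q
    using assms by (intro cnj_hermitian) (simp add: pos_def_def)
  then show "hermitian (tr_left M)" by (simp add: hermitian_def adj_def tr_left_def vec_eq_iff)
  fix v :: "complex^'b" assume "v \<noteq> 0"
  then obtain i where "v $ i \<noteq> 0" by (auto simp: vec_eq_iff)
  have "(\<chi> p. if fst p = j then v $ snd p else 0) \<noteq> 0" for j :: 'a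
  proof
    assume "(\<chi> p. if fst p = j then v $ snd p else 0) = 0"
    from arg_cong[OF this, of "\<lambda>x. x $ (j, i)"] show False
      using \<open>v $ i \<noteq> 0\<close> by simp
  qed
  then have "0 < Re (quad M (\<chi> p. if fst p = j then v $ snd p else 0))" for j :: 'a
    using assms unfolding pos_def_def by blast
  then show "0 < Re (quad (tr_left M) v)"
    unfolding quad_tr_left Re_sum by (intro sum_pos) simp_all
qed

text \<open>In matrix notation, \<open>chain G H\<close> is $(G \otimes I_C)(I_A \otimes H)$.\<close>

definition chain :: "('a::finite \<times> 'b::finite) cmat \<Rightarrow> ('b \<times> 'c::finite) cmat \<Rightarrow> ('a \<times> 'b \<times> 'c) cmat" where
  "chain G H = (\<chi> p q. \<Sum>b\<in>UNIV. G $ (fst p, fst (snd p)) $ (fst q, b) * H $ (b, snd (snd p)) $ snd q)"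

lemma chain_one_right: "chain G (mat 1) = reassoc (kron G (mat 1))"
  by (auto simp: chain_def reassoc_def kron_def mat_def vec_eq_iff mult_delta_left mult_delta_right)

lemma chain_one_left: "chain (mat 1) H = kron (mat 1) H"
  by (auto simp: chain_def kron_def mat_def vec_eq_iff mult_delta_left mult_delta_right)

text \<open>First \<open>H\<close> acts with the \<open>A\<close> index fixed, giving
  \<open>y\<close>, then \<open>G\<close> acts with the \<open>C\<close> index fixed. Both stages
  preserve the sum of squared moduli.\<close>

lemma norm_chain_isometry:
  assumes G: "adj G ** G = mat 1" and H: "adj H ** H = mat 1"
  shows "norm (chain G H *v v) \<le> norm v"
proof -
  have G': "(\<Sum>i\<in>UNIV. cnj (G $ i $ j) * G $ i $ j') = (if j = j' then 1 else 0)" for j j'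
    using arg_cong[OF G, of "\<lambda>M. M $ j $ j'"] by (simp add: matrix_matrix_mult_def adj_def mat_def)
  have H': "(\<Sum>i\<in>UNIV. cnj (H $ i $ j) * H $ i $ j') = (if j = j' then 1 else 0)" for j j'
    using arg_cong[OF H, of "\<lambda>M. M $ j $ j'"] by (simp add: matrix_matrix_mult_def adj_def mat_def)
  define y where "y a s = (\<Sum>r\<in>UNIV. H $ s $ r * v $ (a, r))" for a s
  have e: "(chain G H *v v) $ (a, b, c) = (\<Sum>q\<in>UNIV. G $ (a, b) $ q * y (fst q) (snd q, c))" for a b c
  proof -
    have "(chain G H *v v) $ (a, b, c) = (\<Sum>a'\<in>UNIV. \<Sum>r\<in>UNIV. \<Sum>b'\<in>UNIV. G $ (a, b) $ (a', b') * H $ (b', c) $ r * v $ (a', r))"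
      by (simp add: matrix_vector_mult_def chain_def sum_UNIV_prod[where 'a='a] sum_distrib_right)
    also have "\<dots> = (\<Sum>a'\<in>UNIV. \<Sum>b'\<in>UNIV. \<Sum>r\<in>UNIV. G $ (a, b) $ (a', b') * H $ (b', c) $ r * v $ (a', r))"
      by (intro sum.cong refl sum.swap)
    also have "\<dots> = (\<Sum>q\<in>UNIV. G $ (a, b) $ q * y (fst q) (snd q, c))"
      by (simp add: y_def sum_UNIV_prod[where 'a='a] sum_distrib_left mult_ac)
    finally show ?thesis .
  qed
  have "(norm (chain G H *v v))\<^sup>2 = (\<Sum>a\<in>UNIV. \<Sum>b\<in>UNIV. \<Sum>c\<in>UNIV. (norm (\<Sum>q\<in>UNIV. G $ (a, b) $ q * y (fst q) (snd q, c)))\<^sup>2)"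
    by (simp add: norm_vec_sq sum_UNIV_prod[where 'b="'b \<times> 'c"] sum_UNIV_prod[where 'b="'c"] e)
  also have "\<dots> = (\<Sum>p\<in>UNIV. \<Sum>c\<in>UNIV. (norm (\<Sum>q\<in>UNIV. G $ p $ q * y (fst q) (snd q, c)))\<^sup>2)"
    by (simp add: sum_UNIV_prod[where f="\<lambda>p. \<Sum>c\<in>UNIV. g p c" for g])
  also have "\<dots> = (\<Sum>c\<in>UNIV. \<Sum>p\<in>UNIV. (norm (\<Sum>q\<in>UNIV. G $ p $ q * y (fst q) (snd q, c)))\<^sup>2)"
    by (rule sum.swap)
  also have "\<dots> = (\<Sum>c\<in>UNIV. \<Sum>q\<in>UNIV. (norm (y (fst q) (snd q, c)))\<^sup>2)"
    by (intro sum.cong refl sum_isometry) (simp_all add: G')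
  also have "\<dots> = (\<Sum>q\<in>UNIV. \<Sum>c\<in>UNIV. (norm (y (fst q) (snd q, c)))\<^sup>2)"
    by (rule sum.swap)
  also have "\<dots> = (\<Sum>a\<in>UNIV. \<Sum>s\<in>UNIV. (norm (y a s))\<^sup>2)"
    by (simp add: sum_UNIV_prod)
  also have "\<dots> = (\<Sum>a\<in>UNIV. \<Sum>r\<in>UNIV. (norm (v $ (a, r)))\<^sup>2)"
    unfolding y_def by (intro sum.cong refl sum_isometry) (simp_all add: H')
  also have "\<dots> = (norm v)\<^sup>2"
    by (simp add: norm_vec_sq sum_UNIV_prod[where 'a='a])
  finally show ?thesis by (simp add: power2_eq_iff_nonneg)
qed

text \<open>Regroup the indices: as a map from $A$ to $A \otimes B \otimes B$, $G$ is an isometry by the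
  first hypothesis; as a map from $B \otimes B \otimes C$ to $C$, $H$ is a coisometry by the second.\<close>

lemma norm_chain_partial_isometry:
  fixes G :: "('a::finite \<times> 'b::finite) cmat" and H :: "('b \<times> 'c::finite) cmat"
  assumes G: "tr_right (adj G ** G) = mat 1" and H: "tr_left (H ** adj H) = mat 1"
  shows "norm (chain G H *v v) \<le> norm v"
proof -
  have G': "(\<Sum>i\<in>UNIV. cnj (G $ fst i $ (j, snd i)) * G $ fst i $ (j', snd i)) = (if j = j' then 1 else 0)" for j j'
    using arg_cong[OF G, of "\<lambda>M. M $ j $ j'"] 
    by (subst sum_UNIV_prod, subst sum.swap) (simp add: matrix_matrix_mult_def adj_def mat_def tr_right_def)
  have H': "(\<Sum>j\<in>UNIV. H $ (fst j, i) $ snd j * cnj (H $ (fst j, i') $ snd j)) = (if i = i' then 1 else 0)" for i i'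
    using arg_cong[OF H, of "\<lambda>M. M $ i $ i'"] 
    by (subst sum_UNIV_prod) (simp add: matrix_matrix_mult_def adj_def mat_def tr_left_def)
  \<comment> \<open>The pair \<open>s\<close> joins the intermediate \<open>B\<close> index to the
    input \<open>BC\<close> index. Here \<open>G\<close> contracts only the \<open>A\<close> index;
    the intermediate \<open>B\<close> index is left open for \<open>H\<close>.\<close>
  define y where "y p s = (\<Sum>a\<in>UNIV. G $ p $ (a, fst s) * v $ (a, snd s))" for p s
  have e: "(chain G H *v v) $ (a, b, c) = (\<Sum>s\<in>UNIV. H $ (fst s, c) $ snd s * y (a, b) s)" for a b c
  proof -
    have "(chain G H *v v) $ (a, b, c) = (\<Sum>a'\<in>UNIV. \<Sum>r\<in>UNIV. \<Sum>b'\<in>UNIV. G $ (a, b) $ (a', b') * H $ (b', c) $ r * v $ (a', r))"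
      by (simp add: matrix_vector_mult_def chain_def sum_UNIV_prod[where 'a='a] sum_distrib_right)
    also have "\<dots> = (\<Sum>a'\<in>UNIV. \<Sum>b'\<in>UNIV. \<Sum>r\<in>UNIV. G $ (a, b) $ (a', b') * H $ (b', c) $ r * v $ (a', r))"
      by (intro sum.cong refl sum.swap)
    also have "\<dots> = (\<Sum>a'\<in>UNIV. \<Sum>s\<in>UNIV. G $ (a, b) $ (a', fst s) * H $ (fst s, c) $ snd s * v $ (a', snd s))"
      by (simp add: sum_UNIV_prod[where 'a='b])
    also have "\<dots> = (\<Sum>s\<in>UNIV. \<Sum>a'\<in>UNIV. G $ (a, b) $ (a', fst s) * H $ (fst s, c) $ snd s * v $ (a', snd s))"
      by (rule sum.swap)
    also have "\<dots> = (\<Sum>s\<in>UNIV. H $ (fst s, c) $ snd s * y (a, b) s)"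
      by (simp add: y_def sum_distrib_left mult_ac)
    finally show ?thesis .
  qed
  have "(norm (chain G H *v v))\<^sup>2 = (\<Sum>a\<in>UNIV. \<Sum>b\<in>UNIV. \<Sum>c\<in>UNIV. (norm (\<Sum>s\<in>UNIV. H $ (fst s, c) $ snd s * y (a, b) s))\<^sup>2)"
    by (simp add: norm_vec_sq sum_UNIV_prod[where 'b="'b \<times> 'c"] sum_UNIV_prod[where 'b="'c"] e)
  \<comment> \<open>For fixed \<open>a\<close> and \<open>b\<close>, the regrouped \<open>H\<close>
    sends the index \<open>s\<close> to \<open>c\<close>. Being only a coisometry, it yields an
    inequality.\<close>
  also have "\<dots> \<le> (\<Sum>a\<in>UNIV. \<Sum>b\<in>UNIV. \<Sum>s\<in>UNIV. (norm (y (a, b) s))\<^sup>2)"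
    by (intro sum_mono sum_coisometry) (simp_all add: H')
  also have "\<dots> = (\<Sum>a\<in>UNIV. \<Sum>b\<in>UNIV. \<Sum>b'\<in>UNIV. \<Sum>r\<in>UNIV. (norm (y (a, b) (b', r)))\<^sup>2)"
    by (simp add: sum_UNIV_prod[where 'a='b])
  also have "\<dots> = (\<Sum>i\<in>UNIV. \<Sum>r\<in>UNIV. (norm (y (fst i) (snd i, r)))\<^sup>2)"
    by (simp add: sum_UNIV_prod[where f="\<lambda>p. \<Sum>c\<in>UNIV. g p c" for g])
  also have "\<dots> = (\<Sum>r\<in>UNIV. \<Sum>i\<in>UNIV. (norm (y (fst i) (snd i, r)))\<^sup>2)"
    by (rule sum.swap)
  also have "\<dots> = (\<Sum>r\<in>UNIV. \<Sum>a\<in>UNIV. (norm (v $ (a, r)))\<^sup>2)"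
    unfolding y_def fst_conv snd_conv by (intro sum.cong refl sum_isometry) (simp_all add: G')
  also have "\<dots> = (\<Sum>a\<in>UNIV. \<Sum>r\<in>UNIV. (norm (v $ (a, r)))\<^sup>2)"
    by (rule sum.swap)
  also have "\<dots> = (norm v)\<^sup>2"
    by (simp add: norm_vec_sq sum_UNIV_prod[where 'a='a])
  finally show ?thesis by (simp add: power2_le_iff_abs_le)
qed

section \<open>Complex powers and their derivatives\<close>

text \<open>For positive \<open>d\<close> this is the power \<open>A^z\<close> of the matrix with
  eigenbasis \<open>U\<close> and eigenvalues \<open>d\<close>. Taking the decomposition as argument
  ties the powers to the one that \<open>mlog\<close> has chosen.\<close>

definition mpow :: "'n::finite cmat \<Rightarrow> ('n \<Rightarrow> real) \<Rightarrow> complex \<Rightarrow> 'n cmat" where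
  "mpow U d z = U ** cdiag (\<lambda>i. exp (z * of_real (ln (d i)))) ** adj U"

text \<open>By the spectral theorem the choice in \<open>mlog\<close> has a witness, so the chosen
  logarithm comes with a decomposition of \<open>A\<close>. The same \<open>U\<close> and
  \<open>d\<close> then serve for the complex powers.\<close>

lemma mlog_obtain:
  assumes "pos_def A"
  obtains U d where "unitary U" "mpow U d 1 = A"
    "mlog A = U ** cdiag (\<lambda>i. of_real (ln (d i))) ** adj U"
proof -
  have "\<exists>L U d. unitary U \<and> (\<forall>i. 0 < d i) \<and>
      A = U ** cdiag (\<lambda>i. complex_of_real (d i)) ** adj U \<and>
      L = U ** cdiag (\<lambda>i. complex_of_real (ln (d i))) ** adj U"
    using spectral_pos_def[OF assms] by blast
  from someI_ex[OF this] obtain U d where *: "unitary U" "\<forall>i. 0 < d i"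
      "A = U ** cdiag (\<lambda>i. complex_of_real (d i)) ** adj U"
      "mlog A = U ** cdiag (\<lambda>i. complex_of_real (ln (d i))) ** adj U"
    unfolding mlog_def[symmetric] by blast
  moreover have "mpow U d 1 = A"
    using * by (simp add: mpow_def exp_of_real)
  ultimately show thesis using that by blast
qed

text \<open>The logarithms of the eigenvalues are real, so conjugation affects only the
  exponent.\<close>

lemma adj_mpow: "adj (mpow U d z) = mpow U d (cnj z)"
  by (simp add: mpow_def adj_mult adj_cdiag exp_cnj matrix_mul_assoc)

lemma mpow_add:
  assumes "unitary U"
  shows "mpow U d z ** mpow U d w = mpow U d (z + w)"
proof -
  have "mpow U d z ** mpow U d w = U ** cdiag (\<lambda>i. exp (z * of_real (ln (d i)))) ** (adj U ** U)
      ** cdiag (\<lambda>i. exp (w * of_real (ln (d i)))) ** adj U"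
    by (simp add: mpow_def matrix_mul_assoc)
  also have "\<dots> = U ** (cdiag (\<lambda>i. exp (z * of_real (ln (d i)))) ** cdiag (\<lambda>i. exp (w * of_real (ln (d i))))) ** adj U"
    using assms by (simp add: unitary_def matrix_mul_assoc)
  finally show ?thesis by (simp add: mpow_def cdiag_mult exp_add ring_distribs)
qed

lemma mpow_zero:
  assumes "unitary U"
  shows "mpow U d 0 = mat 1"
  using assms by (simp add: mpow_def cdiag_one unitary_def)

lemma mlog_hermitian:
  assumes "pos_def A"
  shows "adj (mlog A) = mlog A"
proof -
  obtain U d where "mlog A = U ** cdiag (\<lambda>i. of_real (ln (d i))) ** adj U"
    using mlog_obtain[OF assms] by metis
  then show ?thesis by (simp add: adj_mult adj_cdiag matrix_mul_assoc)
qed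

section \<open>Entrywise complex derivatives of matrix functions\<close>

definition has_mat_derivative :: "(complex \<Rightarrow> 'n::finite cmat) \<Rightarrow> 'n cmat \<Rightarrow> complex \<Rightarrow> bool" where
  "has_mat_derivative F F' z \<longleftrightarrow> (\<forall>i j. ((\<lambda>z. F z $ i $ j) has_field_derivative F' $ i $ j) (at z))"

lemma has_mat_derivative_const: "has_mat_derivative (\<lambda>z. A) 0 z"
  by (simp add: has_mat_derivative_def)

lemma has_mat_derivative_mult:
  assumes "has_mat_derivative F F' z" "has_mat_derivative G G' z"
  shows "has_mat_derivative (\<lambda>z. F z ** G z) (F' ** G z + F z ** G') z"
  using assms unfolding has_mat_derivative_def matrix_matrix_mult_def
  by (auto intro!: derivative_eq_intros simp: sum.distrib mult.commute)

lemma has_mat_derivative_kron: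
  assumes "has_mat_derivative F F' z" "has_mat_derivative G G' z"
  shows "has_mat_derivative (\<lambda>z. kron (F z) (G z)) (kron F' (G z) + kron (F z) G') z"
  using assms unfolding has_mat_derivative_def kron_def
  by (auto intro!: derivative_eq_intros)

lemma has_mat_derivative_chain:
  assumes "has_mat_derivative F F' z" "has_mat_derivative G G' z"
  shows "has_mat_derivative (\<lambda>z. chain (F z) (G z)) (chain F' (G z) + chain (F z) G') z"
  using assms unfolding has_mat_derivative_def chain_def
  by (auto intro!: derivative_eq_intros simp: sum.distrib mult.commute)

lemma has_mat_derivative_quad:
  assumes "has_mat_derivative F F' z"
  shows "((\<lambda>z. quad (F z) v) has_field_derivative quad F' v) (at z)"
  using assms unfolding has_mat_derivative_def quad_def
  by (auto intro!: derivative_eq_intros simp: mult_ac)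

lemma has_mat_derivative_cdiag:
  assumes "\<And>i. ((\<lambda>z. f z i) has_field_derivative f' i) (at z)"
  shows "has_mat_derivative (\<lambda>z. cdiag (f z)) (cdiag f') z"
  using assms by (auto simp: has_mat_derivative_def cdiag_def)

lemma has_mat_derivative_mpow:
  "has_mat_derivative (\<lambda>z. mpow U d (c * z))
     (U ** cdiag (\<lambda>i. c * of_real (ln (d i)) * exp (c * z * of_real (ln (d i)))) ** adj U) z"
proof -
  have "has_mat_derivative (\<lambda>z. cdiag (\<lambda>i. exp (c * z * of_real (ln (d i)))))
          (cdiag (\<lambda>i. c * of_real (ln (d i)) * exp (c * z * of_real (ln (d i))))) z"
    by (rule has_mat_derivative_cdiag) (auto intro!: derivative_eq_intros simp: mult_ac)
  from has_mat_derivative_mult[OF has_mat_derivative_mult[OF has_mat_derivative_const this]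
      has_mat_derivative_const]
  show ?thesis by (simp add: mpow_def)
qed

text \<open>At 0 the exponentials equal 1 and only \<open>c\<close> times the logarithm is left. The
  complex scalar is encoded as the scalar matrix \<open>mat c\<close>.\<close>

lemma has_mat_derivative_mpow_0:
  "has_mat_derivative (\<lambda>z. mpow U d (c * z))
     (mat c ** (U ** cdiag (\<lambda>i. of_real (ln (d i))) ** adj U)) 0"
proof -
  have "U ** cdiag (\<lambda>i. c * of_real (ln (d i))) = mat c ** (U ** cdiag (\<lambda>i. of_real (ln (d i))))"
    by (simp add: vec_eq_iff matrix_matrix_mult_def cdiag_def mat_def if_distrib if_distribR mult_ac cong: if_cong)
  then show ?thesis
    using has_mat_derivative_mpow[of U d c 0] by (simp add: matrix_mul_assoc)
qed

text \<open>Along a principal filter, $O(1)$ means bounded on the set.\<close>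

definition mat_bounded :: "(complex \<Rightarrow> 'n::finite cmat) \<Rightarrow> complex set \<Rightarrow> bool" where
  "mat_bounded F S \<longleftrightarrow> (\<forall>i j. (\<lambda>z. F z $ i $ j) \<in> O[principal S](\<lambda>_. 1))"

lemma bigo_one_mult:
  fixes f g :: "complex \<Rightarrow> complex"
  shows "f \<in> O[F](\<lambda>_. 1) \<Longrightarrow> g \<in> O[F](\<lambda>_. 1) \<Longrightarrow> (\<lambda>z. f z * g z) \<in> O[F](\<lambda>_. 1)"
  using landau_o.big.mult[of f F "\<lambda>_. 1" g "\<lambda>_. 1"] by simp

lemma mat_bounded_const: "mat_bounded (\<lambda>z. A) S"
  by (simp add: mat_bounded_def)

lemma mat_bounded_mult:
  assumes "mat_bounded F S" "mat_bounded G S"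
  shows "mat_bounded (\<lambda>z. F z ** G z) S"
  using assms unfolding mat_bounded_def matrix_matrix_mult_def
  by (auto intro!: big_sum_in_bigo bigo_one_mult)

lemma mat_bounded_kron:
  assumes "mat_bounded F S" "mat_bounded G S"
  shows "mat_bounded (\<lambda>z. kron (F z) (G z)) S"
  using assms unfolding mat_bounded_def kron_def
  by (auto intro!: bigo_one_mult)

lemma mat_bounded_chain:
  assumes "mat_bounded F S" "mat_bounded G S"
  shows "mat_bounded (\<lambda>z. chain (F z) (G z)) S"
  using assms unfolding mat_bounded_def chain_def
  by (auto intro!: big_sum_in_bigo bigo_one_mult)

lemma mat_bounded_quad:
  assumes "mat_bounded F S"
  obtains B where "\<And>z. z \<in> S \<Longrightarrow> norm (quad (F z) v) \<le> B"
proof -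
  have "(\<lambda>z. quad (F z) v) \<in> O[principal S](\<lambda>_. 1)"
    using assms unfolding mat_bounded_def quad_def
    by (auto intro!: big_sum_in_bigo bigo_one_mult)
  then obtain B where "\<forall>z\<in>S. norm (quad (F z) v) \<le> B"
    by (auto elim!: landau_o.bigE simp: eventually_principal)
  then show thesis using that by blast
qed

text \<open>For real \<open>c\<close> the modulus of each exponential depends on \<open>Re z\<close>
  alone, which ranges over the unit interval.\<close>

lemma mat_bounded_mpow:
  "mat_bounded (\<lambda>z. mpow U d (of_real c * z)) {z. 0 \<le> Re z \<and> Re z \<le> 1}"
proof -
  have "mat_bounded (\<lambda>z. cdiag (\<lambda>i. exp (of_real c * z * of_real (ln (d i))))) {z. 0 \<le> Re z \<and> Re z \<le> 1}"
    unfolding mat_bounded_def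
  proof (intro allI bigoI)
    fix i j
    have "c * Re z * ln (d i) \<le> \<bar>c\<bar> * \<bar>ln (d i)\<bar>" if "0 \<le> Re z" "Re z \<le> 1" for z
    proof -
      have "c * Re z * ln (d i) \<le> \<bar>c * Re z * ln (d i)\<bar>" by simp
      also have "\<dots> = Re z * (\<bar>c\<bar> * \<bar>ln (d i)\<bar>)" using that by (simp add: abs_mult)
      also have "\<dots> \<le> 1 * (\<bar>c\<bar> * \<bar>ln (d i)\<bar>)" using that by (intro mult_right_mono) auto
      finally show ?thesis by simp
    qed
    then show "\<forall>\<^sub>F z in principal {z. 0 \<le> Re z \<and> Re z \<le> 1}.
        norm (cdiag (\<lambda>i. exp (of_real c * z * of_real (ln (d i)))) $ i $ j) \<le> exp (\<bar>c\<bar> * \<bar>ln (d i)\<bar>) * norm (1::complex)"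
      by (auto simp: eventually_principal cdiag_def norm_exp)
  qed
  from mat_bounded_mult[OF mat_bounded_mult[OF mat_bounded_const this] mat_bounded_const]
  show ?thesis by (simp add: mpow_def)
qed

lemma DERIV_nonpos_at_max_right:
  fixes g :: "real \<Rightarrow> real"
  assumes "(g has_real_derivative D) (at 0)" and "\<And>s. 0 \<le> s \<Longrightarrow> s \<le> 1 \<Longrightarrow> g s \<le> g 0"
  shows "D \<le> 0"
proof (rule ccontr)
  assume "\<not> D \<le> 0"
  then obtain e where e: "e > 0" "\<And>h. 0 < h \<Longrightarrow> h < e \<Longrightarrow> g 0 < g (0 + h)"
    using DERIV_pos_inc_right[OF assms(1)] by auto
  \<comment> \<open>The point lies both in the interval of increase and in the unit
    interval.\<close>
  then have "g 0 < g (min 1 (e / 2))" using e(2)[of "min 1 (e / 2)"] by auto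
  moreover have "g (min 1 (e / 2)) \<le> g 0" using e(1) by (intro assms(2)) auto
  ultimately show False by simp
qed

section \<open>Linear algebra for the derivative at 0\<close>

lemma matrix_add_right: "A ** (B + C) = A ** B + A ** (C :: 'n::finite cmat)"
  by (simp add: vec_eq_iff matrix_matrix_mult_def ring_distribs sum.distrib)

lemma reassoc_kron: "reassoc (kron (kron X Y) Z) = kron X (kron Y Z)"
  by (simp add: reassoc_def kron_def vec_eq_iff mult.assoc)

lemma mat_mult_nth: "(mat c ** M) $ i $ j = c * M $ i $ j"
  by (simp add: matrix_matrix_mult_def mat_def mult_delta_left)

text \<open>The two sums are the derivatives of the two factors at 0, with exponent rates
  \<open>c\<close> and \<open>- c\<close>; the common scalar is extracted from each.\<close>

lemma chain_lincomb:
  "chain (mat c ** M + kron (mat (- c) ** X) Y) H = mat c ** (chain M H - chain (kron X Y) H)"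
  "chain G (kron Y' (mat (- c) ** X') + mat c ** N) = mat c ** (chain G N - chain G (kron Y' X'))"
  by (simp_all add: vec_eq_iff mat_mult_nth chain_def kron_def algebra_simps
      sum.distrib sum_distrib_left sum_subtractf sum_negf)

lemma kron_zero: "kron X 0 = 0" "kron 0 X = 0"
  by (simp_all add: kron_def vec_eq_iff)

lemma quad_scale: "quad (mat c ** M) v = c * quad M v"
  by (simp add: quad_def mat_mult_nth sum_distrib_left mult_ac)

section \<open>The operator inequality\<close>

theorem theorem1:
  fixes \<rho>AB :: "('a::finite \<times> 'b::finite) cmat"
    and \<sigma>BC :: "('b \<times> 'c::finite) cmat"
  assumes "density \<rho>AB" and "pos_def \<rho>AB"
    and "density \<sigma>BC" and "pos_def \<sigma>BC"
  shows "loewner_nonpos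
     (reassoc (kron (mlog \<rho>AB) (mat 1 :: 'c cmat))
      - kron (mlog (tr_right \<rho>AB)) (mat 1 :: ('b \<times> 'c) cmat)
      + kron (mat 1 :: 'a cmat) (mlog \<sigma>BC)
      - reassoc (kron (mat 1 :: ('a \<times> 'b) cmat) (mlog (tr_left \<sigma>BC))))"
proof -
  have pA: "pos_def (tr_right \<rho>AB)" and pC: "pos_def (tr_left \<sigma>BC)"
    using assms by (auto intro: pos_def_tr_right pos_def_tr_left)
  obtain U1 d1 where 1: "unitary U1" "mpow U1 d1 1 = \<rho>AB"
    "mlog \<rho>AB = U1 ** cdiag (\<lambda>i. of_real (ln (d1 i))) ** adj U1"
    using mlog_obtain[OF assms(2)] by metis
  obtain U2 d2 where 2: "unitary U2" "mpow U2 d2 1 = tr_right \<rho>AB"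
    "mlog (tr_right \<rho>AB) = U2 ** cdiag (\<lambda>i. of_real (ln (d2 i))) ** adj U2"
    using mlog_obtain[OF pA] by metis
  obtain U3 d3 where 3: "unitary U3" "mpow U3 d3 1 = \<sigma>BC"
    "mlog \<sigma>BC = U3 ** cdiag (\<lambda>i. of_real (ln (d3 i))) ** adj U3"
    using mlog_obtain[OF assms(4)] by metis
  obtain U4 d4 where 4: "unitary U4" "mpow U4 d4 1 = tr_left \<sigma>BC"
    "mlog (tr_left \<sigma>BC) = U4 ** cdiag (\<lambda>i. of_real (ln (d4 i))) ** adj U4"
    using mlog_obtain[OF pC] by metis
  \<comment> \<open>Half exponents make the joint density matrix appear to the power
    \<open>Re z\<close> in \<open>adj (G z) ** G z\<close> and \<open>H z ** adj (H z)\<close>. Both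
    rates are written as embedded reals to fit \<open>mat_bounded_mpow\<close>.\<close>
  define c where "c = complex_of_real (1/2)"
  define c' where "c' = complex_of_real (-1/2)"
  have c': "c' = - c" by (simp add: c_def c'_def)
  define G where "G z = mpow U1 d1 (c * z) ** kron (mpow U2 d2 (c' * z)) (mat 1 :: 'b cmat)" for z
  define H where "H z = kron (mat 1 :: 'b cmat) (mpow U4 d4 (c' * z)) ** mpow U3 d3 (c * z)" for z
  define F where "F z = chain (G z) (H z)" for z
  define T where "T = reassoc (kron (mlog \<rho>AB) (mat 1 :: 'c cmat))
      - kron (mlog (tr_right \<rho>AB)) (mat 1 :: ('b \<times> 'c) cmat)
      + kron (mat 1 :: 'a cmat) (mlog \<sigma>BC)
      - reassoc (kron (mat 1 :: ('a \<times> 'b) cmat) (mlog (tr_left \<sigma>BC)))"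
  note zero = mpow_zero[OF 1(1)] mpow_zero[OF 2(1)] mpow_zero[OF 3(1)] mpow_zero[OF 4(1)]
  have GG: "adj (G z) ** G z = kron (mpow U2 d2 (c' * cnj z)) (mat 1) **
      mpow U1 d1 (of_real (Re z)) ** kron (mpow U2 d2 (c' * z)) (mat 1)" for z
  proof -
    have "c * cnj z + c * z = of_real (Re z)" by (simp add: c_def complex_eq_iff)
    then have "mpow U1 d1 (c * cnj z) ** mpow U1 d1 (c * z) = mpow U1 d1 (of_real (Re z))"
      by (simp add: mpow_add[OF 1(1)])
    then show ?thesis
      by (simp add: G_def adj_mult adj_kron adj_mpow c_def c'_def flip: matrix_mul_assoc)
         (simp add: matrix_mul_assoc)
  qed
  have HH: "H z ** adj (H z) = kron (mat 1) (mpow U4 d4 (c' * z)) **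
      mpow U3 d3 (of_real (Re z)) ** kron (mat 1) (mpow U4 d4 (c' * cnj z))" for z
  proof -
    have "c * z + c * cnj z = of_real (Re z)" by (simp add: c_def complex_eq_iff)
    then have "mpow U3 d3 (c * z) ** mpow U3 d3 (c * cnj z) = mpow U3 d3 (of_real (Re z))"
      by (simp add: mpow_add[OF 3(1)])
    then show ?thesis
      by (simp add: H_def adj_mult adj_kron adj_mpow c_def c'_def flip: matrix_mul_assoc)
         (simp add: matrix_mul_assoc)
  qed
  have bdry: "norm (F z *v v) \<le> norm v" if "Re z = 0 \<or> Re z = 1" for z v
    using that
  proof
    assume z: "Re z = 0"
    then have "c' * cnj z + c' * z = 0" "c' * z + c' * cnj z = 0"
      by (simp_all add: c'_def complex_eq_iff)
    then have "adj (G z) ** G z = mat 1" "H z ** adj (H z) = mat 1"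
      by (simp_all add: GG HH z zero kron_mult mpow_add 2(1) 4(1))
    then show ?thesis unfolding F_def
      \<comment> \<open>\<open>H z\<close> is square, so its right inverse \<open>adj (H z)\<close>
        is also a left inverse.\<close>
      by (intro norm_chain_isometry) (simp_all add: matrix_left_right_inverse)
  next
    assume z: "Re z = 1"
    have e: "c' * cnj z + 1 + c' * z = 0" "c' * z + 1 + c' * cnj z = 0"
      using z by (simp_all add: c'_def complex_eq_iff)
    \<comment> \<open>The partial trace replaces the joint density matrix by its marginal, leaving
      three powers in one eigenbasis whose exponents sum to \<open>1 - Re z = 0\<close>.\<close>
    have "tr_right (adj (G z) ** G z) = mpow U2 d2 (c' * cnj z) ** mpow U2 d2 1 ** mpow U2 d2 (c' * z)"
      by (simp add: GG z 1(2) 2(2) tr_right_kron_right tr_right_kron_left)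
    then have t: "tr_right (adj (G z) ** G z) = mat 1"
      by (simp add: mpow_add 2(1) e zero)
    have "tr_left (H z ** adj (H z)) = mpow U4 d4 (c' * z) ** mpow U4 d4 1 ** mpow U4 d4 (c' * cnj z)"
      by (simp add: HH z 3(2) 4(2) tr_left_kron_right tr_left_kron_left)
    then have "tr_left (H z ** adj (H z)) = mat 1"
      by (simp add: mpow_add 4(1) e zero)
    with t show ?thesis unfolding F_def by (rule norm_chain_partial_isometry)
  qed
  have "\<exists>F'. has_mat_derivative F F' z" for z
    unfolding F_def G_def H_def
    by (intro exI) (rule has_mat_derivative_chain has_mat_derivative_mult has_mat_derivative_kron
        has_mat_derivative_mpow has_mat_derivative_const)+
  then have hol: "(\<lambda>z. quad (F z) v) holomorphic_on UNIV" for v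
    unfolding holomorphic_on_def field_differentiable_def
    by (metis has_mat_derivative_quad has_field_derivative_at_within)
  have bdd: "mat_bounded F {z. 0 \<le> Re z \<and> Re z \<le> 1}"
    unfolding F_def G_def H_def c_def c'_def
    by (intro mat_bounded_chain mat_bounded_mult mat_bounded_kron mat_bounded_mpow mat_bounded_const)
  \<comment> \<open>Cauchy-Schwarz turns the contraction property on the two boundary lines into the
    bound by the squared norm of \<open>v\<close>, which is positive for nonzero \<open>v\<close>,
    as the three lines theorem requires.\<close>
  have bound: "norm (quad (F z) v) \<le> (norm v)\<^sup>2" if z: "0 \<le> Re z" "Re z \<le> 1" and "v \<noteq> 0" for z v
  proof -
    obtain B where B: "\<And>z. z \<in> {z. 0 \<le> Re z \<and> Re z \<le> 1} \<Longrightarrow> norm (quad (F z) v) \<le> B"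
      using mat_bounded_quad[OF bdd] by metis
    show ?thesis
    proof (rule three_lines_bound[OF hol _ _ _ z])
      fix w assume "Re w = 0 \<or> Re w = 1"
      have "norm (quad (F w) v) \<le> norm v * norm (F w *v v)"
        unfolding quad_eq_cdot by (rule norm_cdot_le)
      also have "\<dots> \<le> norm v * norm v"
        by (intro mult_left_mono bdry \<open>Re w = 0 \<or> Re w = 1\<close>) simp
      finally show "norm (quad (F w) v) \<le> (norm v)\<^sup>2" by (simp add: power2_eq_square)
    qed (use B \<open>v \<noteq> 0\<close> in auto)
  qed
  have GH0: "G 0 = mat 1" "H 0 = mat 1" by (simp_all add: G_def H_def zero)
  have dG: "has_mat_derivative G (mat c ** mlog \<rho>AB + kron (mat (- c) ** mlog (tr_right \<rho>AB)) (mat 1)) 0"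
    using has_mat_derivative_mult[OF has_mat_derivative_mpow_0[of U1 d1 c]
        has_mat_derivative_kron[OF has_mat_derivative_mpow_0[of U2 d2 c'] has_mat_derivative_const[of "mat 1 :: 'b cmat"]]]
    by (simp add: G_def[abs_def] zero kron_zero 1(3) 2(3) c')
  have dH: "has_mat_derivative H (kron (mat 1) (mat (- c) ** mlog (tr_left \<sigma>BC)) + mat c ** mlog \<sigma>BC) 0"
    using has_mat_derivative_mult[OF has_mat_derivative_kron[OF has_mat_derivative_const[of "mat 1 :: 'b cmat"]
        has_mat_derivative_mpow_0[of U4 d4 c']] has_mat_derivative_mpow_0[of U3 d3 c]]
    by (simp add: H_def[abs_def] zero kron_zero 3(3) 4(3) c')
  have I4: "reassoc (kron (mat 1 :: ('a \<times> 'b) cmat) Y) = kron (mat 1) (kron (mat 1) Y)" for Y :: "'c cmat"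
    by (simp flip: reassoc_kron)
  have dF: "has_mat_derivative F (mat c ** T) 0"
  proof -
    \<comment> \<open>Product rule at 0, where both factors are the identity: the \<open>G\<close>
      half contributes the two logarithms for \<open>\<rho>AB\<close>, the \<open>H\<close> half the
      two for \<open>\<sigma>BC\<close>.\<close>
    have "mat c ** T = chain (mat c ** mlog \<rho>AB + kron (mat (- c) ** mlog (tr_right \<rho>AB)) (mat 1)) (H 0)
       + chain (G 0) (kron (mat 1) (mat (- c) ** mlog (tr_left \<sigma>BC)) + mat c ** mlog \<sigma>BC)"
      unfolding GH0 chain_lincomb
      by (simp add: T_def I4 chain_one_left chain_one_right reassoc_kron algebra_simps flip: matrix_add_right)
    then show ?thesis
      using has_mat_derivative_chain[OF dG dH] unfolding F_def by simp
  qed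
  have "Re (quad T v) \<le> 0" for v
  proof (cases "v = 0")
    case True
    then show ?thesis by (simp add: quad_def)
  next
    case False
    have F0: "quad (F 0) v = of_real ((norm v)\<^sup>2)"
      by (simp add: F_def GH0 chain_one_left quad_eq_cdot cdot_self)
    have "((\<lambda>z. quad (F z) v) has_field_derivative c * quad T v) (at (of_real 0))"
      using has_mat_derivative_quad[OF dF] by (simp add: quad_scale)
    \<comment> \<open>Restriction to the real axis. The real part is then a real function on the
      unit interval that attains its upper bound, the squared norm of \<open>v\<close>, at
      \<open>s = 0\<close>.\<close>
    then have "((\<lambda>s. quad (F (of_real s)) v) has_vector_derivative c * quad T v) (at 0)"
      by (rule has_vector_derivative_real_field)
    then have "((\<lambda>s. Re (quad (F (of_real s)) v)) has_real_derivative Re (c * quad T v)) (at 0)"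
      unfolding has_real_derivative_iff_has_vector_derivative
      by (rule bounded_linear.has_vector_derivative[OF bounded_linear_Re])
    then have "Re (c * quad T v) \<le> 0"
    proof (rule DERIV_nonpos_at_max_right)
      fix s :: real assume "0 \<le> s" "s \<le> 1"
      have "Re (quad (F (of_real s)) v) \<le> norm (quad (F (of_real s)) v)" by (rule complex_Re_le_cmod)
      also have "\<dots> \<le> (norm v)\<^sup>2" using \<open>0 \<le> s\<close> \<open>s \<le> 1\<close> False by (intro bound) auto
      finally show "Re (quad (F (of_real s)) v) \<le> Re (quad (F (of_real 0)) v)" by (simp add: F0)
    qed
    then show ?thesis by (simp add: c_def)
  qed
  moreover have "Re (quad (- T) v) = - Re (quad T v)" for v
    by (simp add: quad_def sum_negf)
  moreover have "adj (- T) = - T"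
  proof -
    have *: "adj (X - Y) = adj X - adj Y" "adj (X + Y) = adj X + adj Y" "adj (- X) = - adj X"
      for X Y :: "('a \<times> 'b \<times> 'c) cmat"
      by (simp_all add: adj_def vec_eq_iff)
    show ?thesis
      unfolding T_def * adj_reassoc adj_kron adj_one
      by (simp only: mlog_hermitian[OF assms(2)] mlog_hermitian[OF assms(4)] mlog_hermitian[OF pA] mlog_hermitian[OF pC])
  qed
  ultimately show ?thesis
    unfolding T_def[symmetric] by (simp add: loewner_nonpos_def psd_def hermitian_def)
qed

end
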